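(* Let $0< \alpha< 1$ and $1< \beta <4/3$. The Booth lemniscate starlikeness radius of order $\alpha$ for the class $M(\beta)$ is $$R_{\mathcal{BS}(\alpha)}(M(\beta))=\begin{cases}\dfrac{1}{1+2(1-\alpha)( \beta-1)}, & 1< \beta\leq 1+ \dfrac{1-\alpha}{8\alpha},\\[3mm] \dfrac{2\sqrt{\alpha}}{(1+\alpha)\sqrt{ 1+16\alpha ( \beta-1)^2}}, & 1+ \dfrac{1-\alpha}{8\alpha}\leq \beta< \dfrac{4}{3}.\end{cases}$$
   Context: $\mathbb{D}=\{z\in\mathbb{C}:|z|<1\}$. $\mathcal{A}$ is the class of analytic functions $f$ on $\mathbb{D}$ with $f(0)=0$, $f'(0)=1$. The expression $zf'(z)/f(z)$ takes the value $1$ at $z=0$; in conditions on it, it is understood to be analytic. For $0\le\alpha<1$, $G_\alpha(z)=1+\dfrac{z}{1-\alpha z^2}$ on $\mathbb{D}$. For a class $\mathcal{M}\subseteq\mathcal{A}$ and $f\in\mathcal{M}$ let $$R_f=\sup\left\{r\in(0,1): \frac{zf'(z)}{f(z)}\in G_\alpha(\mathbb{D})\text{ for all }|z|\le r\right\},\qquad R_{\mathcal{BS}(\alpha)}(\mathcal{M})=\inf\{R_f: f\in\mathcal{M}\}.$$ The number $R_{\mathcal{BS}(\alpha)}(\mathcal{M})$ is called the Booth lemniscate starlikeness radius of order $\alpha$ of $\mathcal{M}$. For $1<\beta<4/3$, $M(\beta)$ is the class of $f\in\mathcal{A}$ with $\operatorname{Re}\left(zf'(z)/f(z)\right)<\beta$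 for all $z\in\mathbb{D}$. *)

theory Defs
  imports "HOL-Complex_Analysis.Complex_Analysis"
begin

definition normalized_analytic :: "(complex \<Rightarrow> complex) set" where
  "normalized_analytic = {f. f holomorphic_on ball 0 1 \<and> f 0 = 0 \<and> deriv f 0 = 1}"

text \<open>
  The expression \<open>z f'(z) / f(z)\<close>. For a normalized \<open>f\<close> it has a removable singularity
  at \<open>0\<close> with value \<open>1\<close>.
\<close>
definition starlike_quotient :: "(complex \<Rightarrow> complex) \<Rightarrow> complex \<Rightarrow> complex" where
  "starlike_quotient f z = (if z = 0 then 1 else z * deriv f z / f z)"

definition booth_fun :: "real \<Rightarrow> complex \<Rightarrow> complex" where
  "booth_fun \<alpha> z = 1 + z / (1 - of_real \<alpha> * z\<^sup>2)"

definition booth_radius_of :: "real \<Rightarrow> (complex \<Rightarrow> complex) \<Rightarrow> real" where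
  "booth_radius_of \<alpha> f =
     Sup {r. 0 < r \<and> r < 1 \<and>
             (\<forall>z. cmod z \<le> r \<longrightarrow> starlike_quotient f z \<in> booth_fun \<alpha> ` ball 0 1)}"

definition booth_starlikeness_radius :: "real \<Rightarrow> (complex \<Rightarrow> complex) set \<Rightarrow> real" where
  "booth_starlikeness_radius \<alpha> M = Inf {booth_radius_of \<alpha> f | f. f \<in> M}"

text \<open>
  Analyticity of the quotient is required explicitly. At a zero of \<open>f\<close> in the punctured disc
  the quotient has a genuine pole (where division by zero assigns the value \<open>0\<close>), so this
  requirement says precisely that \<open>f\<close> has no zero in the disc other than \<open>0\<close>.
\<close>
definition class_M :: "real \<Rightarrow> (complex \<Rightarrow> complex) set" where
  "class_M \<beta> = {f \<in> normalized_analytic.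
     starlike_quotient f holomorphic_on ball 0 1 \<and>
     (\<forall>z\<in>ball 0 1. Re (starlike_quotient f z) < \<beta>)}"

end

theory Submission
  imports Defs
begin

text \<open>
  Put \<open>c = 1 / (2 (\<beta> - 1))\<close> and \<open>v = 1 / (q - 1)\<close>, where \<open>q = z f' / f\<close>. By the Schwarz lemma, the
  condition \<open>Re q < \<beta>\<close> means \<open>\<bar>v - c\<bar> \<ge> c / \<bar>z\<bar>\<close>, while \<open>q\<close> lies in the Booth domain iff \<open>v\<close> lies outside
  the ellipse with semi-axes \<open>1 - \<alpha>\<close> and \<open>1 + \<alpha>\<close>. So the radius is \<open>c / d\<close>, where \<open>d\<close> is the largest
  distance from \<open>c\<close> to a point of the ellipse; the two cases of the theorem correspond to this
  maximum being attained at the vertex \<open>-(1 - \<alpha>)\<close> or at a pair of conjugate points.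
  The extremal function is \<open>z (1 - z)\<^bsup>2(\<beta>-1)\<^esup>\<close>.
\<close>

section \<open>Geometry of the Booth domain in the coordinate \<open>v = 1 / u\<close>\<close>

text \<open>Source of the ellipses: \<open>1 / z - a * z\<close> maps circles about 0 to them, and
  \<open>\<rho> = 1\<close>, \<open>a = \<alpha>\<close> gives the one bounding the Booth
  domain.\<close>

lemma inverse_minus_of_polar:
  assumes "\<rho> > 0"
  shows "1 / rcis \<rho> t - of_real a * rcis \<rho> t =
         Complex ((1 / \<rho> - a * \<rho>) * cos t) (- ((1 / \<rho> + a * \<rho>) * sin t))"
proof -
  have "1 / rcis \<rho> t = rcis (1 / \<rho>) (- t)"
    by (metis rcis_inverse inverse_eq_divide)
  then show ?thesis
    by (simp add: complex_eq_iff algebra_simps)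
qed

text \<open>The two roots have product \<open>-1 / \<alpha>\<close>, so the smaller one obeys the
  bound. For nonzero \<open>v\<close>, a root in the disc is a preimage of \<open>1 + 1 / v\<close>
  under \<open>booth_fun \<alpha>\<close>.\<close>

lemma booth_preimage_small_root:
  assumes "0 < \<alpha>"
  obtains z :: complex where "of_real \<alpha> * z\<^sup>2 + v * z = 1" "\<alpha> * (cmod z)\<^sup>2 \<le> 1"
proof -
  define s where "s = csqrt (v\<^sup>2 + 4 * of_real \<alpha>)"
  have s2: "s\<^sup>2 = v\<^sup>2 + 4 * of_real \<alpha>"
    unfolding s_def by simp
  define x where "x = (- v + s) / (2 * of_real \<alpha>)"
  define y where "y = (- v - s) / (2 * of_real \<alpha>)"
  have \<alpha>0: "complex_of_real \<alpha> \<noteq> 0"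
    using assms by simp
  have sum: "of_real \<alpha> * (x + y) = - v"
    using \<alpha>0 unfolding x_def y_def by (simp add: field_simps)
  have "of_real \<alpha> * (x * y) = (v\<^sup>2 - s\<^sup>2) / (4 * of_real \<alpha>)"
    using \<alpha>0 unfolding x_def y_def by (simp add: field_simps power2_eq_square)
  then have prod: "of_real \<alpha> * (x * y) = -1"
    using \<alpha>0 s2 by (simp add: field_simps)
  have root: "of_real \<alpha> * x\<^sup>2 + v * x = 1" "of_real \<alpha> * y\<^sup>2 + v * y = 1"
    using sum prod by algebra+
  have "\<alpha> * (cmod x * cmod y) = 1"
    using arg_cong [OF prod, of cmod] assms by (simp add: norm_mult)
  moreover have "(min (cmod x) (cmod y))\<^sup>2 \<le> cmod x * cmod y"
    unfolding power2_eq_square by (intro mult_mono) auto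
  ultimately have "\<alpha> * (min (cmod x) (cmod y))\<^sup>2 \<le> 1"
    using mult_left_mono [of _ _ \<alpha>] assms by fastforce
  then show thesis
    using that root by (cases "cmod x \<le> cmod y") (auto simp: min_def)
qed

text \<open>If the small root had modulus \<open>\<rho> \<ge> 1\<close>, then \<open>1 / u\<close>
  would lie on an ellipse with semi-axes \<open>1 / \<rho> - \<alpha> * \<rho>\<close> and
  \<open>1 / \<rho> + \<alpha> * \<rho>\<close>. As long as
  \<open>\<alpha> * \<rho>\<^sup>2 \<le> 1\<close>, these are at most \<open>1 - \<alpha>\<close>
  and \<open>1 + \<alpha>\<close>, so \<open>1 / u\<close> would not be outside.\<close>

lemma booth_image_outside_ellipse:
  assumes \<alpha>: "0 < \<alpha>" "\<alpha> < 1" and "u \<noteq> 0"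
    and outside: "(Re (1 / u) / (1 - \<alpha>))\<^sup>2 + (Im (1 / u) / (1 + \<alpha>))\<^sup>2 > 1"
  shows "1 + u \<in> booth_fun \<alpha> ` ball 0 1"
proof -
  define v where "v = 1 / u"
  have "v \<noteq> 0"
    using \<open>u \<noteq> 0\<close> by (simp add: v_def)
  obtain z where root: "of_real \<alpha> * z\<^sup>2 + v * z = 1" and small: "\<alpha> * (cmod z)\<^sup>2 \<le> 1"
    using booth_preimage_small_root \<alpha>(1) by blast
  have "z \<noteq> 0"
    using root by auto
  have v: "v = 1 / z - of_real \<alpha> * z"
    using root \<open>z \<noteq> 0\<close> by (simp add: field_simps power2_eq_square)
  have "cmod z < 1"
  proof (rule ccontr)
    assume "\<not> cmod z < 1"
    define \<rho> where "\<rho> = cmod z"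
    define t where "t = Arg z"
    have \<rho>: "1 \<le> \<rho>" "\<alpha> * \<rho>\<^sup>2 \<le> 1"
      using \<open>\<not> cmod z < 1\<close> small by (simp_all add: \<rho>_def)
    have vpolar: "v = Complex ((1 / \<rho> - \<alpha> * \<rho>) * cos t) (- ((1 / \<rho> + \<alpha> * \<rho>) * sin t))"
      unfolding v using inverse_minus_of_polar [of \<rho> t \<alpha>] \<open>z \<noteq> 0\<close>
      by (simp add: \<rho>_def t_def rcis_cmod_Arg)
    have "\<alpha> * \<rho> \<le> \<alpha> * \<rho>\<^sup>2"
      using \<rho>(1) \<alpha>(1) by (simp add: power2_eq_square)
    then have "\<alpha> * \<rho> \<le> 1"
      using \<rho>(2) by linarith
    have "1 / \<rho> \<le> 1" "\<alpha> \<le> \<alpha> * \<rho>"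
      using \<rho>(1) \<alpha>(1) by auto
    moreover have "0 \<le> 1 / \<rho> - \<alpha> * \<rho>"
      using \<rho> by (simp add: field_simps power2_eq_square)
    ultimately have A: "(1 / \<rho> - \<alpha> * \<rho>)\<^sup>2 \<le> (1 - \<alpha>)\<^sup>2"
      by (intro power_mono) linarith+
    \<comment> \<open>Expanded and divided by \<open>\<rho>\<close>, this is the bound on the larger
      semi-axis.\<close>
    have "(\<rho> - 1) * (1 - \<alpha> * \<rho>) \<ge> 0"
      using \<rho>(1) \<open>\<alpha> * \<rho> \<le> 1\<close> by simp
    then have "1 / \<rho> + \<alpha> * \<rho> \<le> 1 + \<alpha>"
      using \<rho>(1) by (simp add: field_simps)
    moreover have "0 \<le> 1 / \<rho> + \<alpha> * \<rho>"
      using \<rho>(1) \<alpha>(1) by simp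
    ultimately have B: "(1 / \<rho> + \<alpha> * \<rho>)\<^sup>2 \<le> (1 + \<alpha>)\<^sup>2"
      by (intro power_mono)
    have "(Re v / (1 - \<alpha>))\<^sup>2 = ((1 / \<rho> - \<alpha> * \<rho>)\<^sup>2 / (1 - \<alpha>)\<^sup>2) * (cos t)\<^sup>2"
      by (simp add: vpolar power_mult_distrib power_divide)
    also have "\<dots> \<le> 1 * (cos t)\<^sup>2"
      using A \<alpha> by (intro mult_right_mono) simp_all
    finally have re: "(Re v / (1 - \<alpha>))\<^sup>2 \<le> (cos t)\<^sup>2"
      by simp
    have "(Im v / (1 + \<alpha>))\<^sup>2 = ((1 / \<rho> + \<alpha> * \<rho>)\<^sup>2 / (1 + \<alpha>)\<^sup>2) * (sin t)\<^sup>2"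
      by (simp add: vpolar power_mult_distrib power_divide)
    also have "\<dots> \<le> 1 * (sin t)\<^sup>2"
      using B \<alpha> by (intro mult_right_mono) simp_all
    finally show False
      using re outside sin_cos_squared_add [of t] unfolding v_def by linarith
  qed
  moreover have "u = z / (1 - of_real \<alpha> * z\<^sup>2)"
  proof -
    have "1 - of_real \<alpha> * z\<^sup>2 = v * z"
      using root by (simp add: algebra_simps)
    then show ?thesis
      using \<open>z \<noteq> 0\<close> \<open>u \<noteq> 0\<close> by (simp add: v_def)
  qed
  ultimately show ?thesis
    by (auto simp: booth_fun_def)
qed

text \<open>The map \<open>z / (1 - \<alpha> * z\<^sup>2)\<close> agrees at \<open>z\<close> and
  \<open>\<zeta>\<close> only if \<open>z = \<zeta>\<close> or
  \<open>\<alpha> * z * \<zeta> = -1\<close>; with \<open>\<zeta>\<close> on the unit circle, both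
  force \<open>z\<close> out of the open disc.\<close>

lemma booth_image_avoids_ellipse:
  assumes \<alpha>: "0 < \<alpha>" "\<alpha> < 1" and \<zeta>: "cmod \<zeta> = 1"
  shows "1 + 1 / (1 / \<zeta> - of_real \<alpha> * \<zeta>) \<notin> booth_fun \<alpha> ` ball 0 1"
proof
  assume "1 + 1 / (1 / \<zeta> - of_real \<alpha> * \<zeta>) \<in> booth_fun \<alpha> ` ball 0 1"
  then obtain z where z: "cmod z < 1"
    and eq: "1 / (1 / \<zeta> - of_real \<alpha> * \<zeta>) = z / (1 - of_real \<alpha> * z\<^sup>2)"
    by (auto simp: booth_fun_def)
  \<comment> \<open>No denominator vanishes on the closed disc, so cross-multiplying is sound
    although division by zero yields 0.\<close>
  have nz: "1 - of_real \<alpha> * x\<^sup>2 \<noteq> 0" if "cmod x \<le> 1" for x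
  proof
    assume "1 - of_real \<alpha> * x\<^sup>2 = 0"
    then have "cmod (of_real \<alpha> * x\<^sup>2) = 1"
      by (metis eq_iff_diff_eq_0 norm_one)
    moreover have "(cmod x)\<^sup>2 \<le> 1"
      using that by (simp add: power_le_one)
    then have "\<alpha> * (cmod x)\<^sup>2 \<le> \<alpha> * 1"
      using \<alpha>(1) by (intro mult_left_mono) auto
    ultimately show False
      using \<alpha> by (simp add: norm_mult norm_power)
  qed
  have "\<zeta> \<noteq> 0"
    using \<zeta> by auto
  have "\<zeta> / (1 - of_real \<alpha> * \<zeta>\<^sup>2) = 1 / (1 / \<zeta> - of_real \<alpha> * \<zeta>)"
    using \<open>\<zeta> \<noteq> 0\<close> nz [of \<zeta>] \<zeta> by (simp add: field_simps power2_eq_square)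
  then have "\<zeta> * (1 - of_real \<alpha> * z\<^sup>2) = z * (1 - of_real \<alpha> * \<zeta>\<^sup>2)"
    using eq nz [of \<zeta>] nz [of z] \<zeta> z by (simp add: frac_eq_eq)
  then have "(\<zeta> - z) * (1 + of_real \<alpha> * (z * \<zeta>)) = 0"
    by (simp add: algebra_simps power2_eq_square)
  moreover have "\<zeta> \<noteq> z"
    using z \<zeta> by auto
  ultimately have "of_real \<alpha> * (z * \<zeta>) = -1"
    by (simp add: add_eq_0_iff)
  then have "cmod (of_real \<alpha> * (z * \<zeta>)) = 1"
    by (simp only: norm_minus_cancel norm_one)
  then have "\<alpha> * cmod z = 1"
    using \<alpha>(1) \<zeta> by (simp add: norm_mult)
  moreover have "\<alpha> * cmod z \<le> 1 * cmod z"
    using \<alpha> by (intro mult_right_mono) auto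
  ultimately show False
    using z by simp
qed

section \<open>Schwarz lemma for \<open>class_M\<close>\<close>

text \<open>The Schwarz lemma bounds a disc map \<open>w\<close> built from the quotient by
  \<open>cmod z\<close>, and the reciprocal of \<open>w z\<close> is
  \<open>1 - 2 * (\<beta> - 1) / u\<close>.\<close>

lemma starlike_quotient_bound_class_M:
  assumes "1 < \<beta>" and f: "f \<in> class_M \<beta>" and z: "cmod z < 1"
    and u: "u = starlike_quotient f z - 1" "u \<noteq> 0"
  shows "1 \<le> cmod z * cmod (1 - 2 * of_real (\<beta> - 1) / u)"
proof -
  define b where "b = \<beta> - 1"
  have "b > 0"
    using assms by (simp add: b_def)
  define q where "q = starlike_quotient f"
  \<comment> \<open>Moebius map of the half-plane \<open>Re q < \<beta>\<close> onto the unit disc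
    taking 1 to 0: the pole \<open>1 + 2 * b\<close> is the mirror image of 1 in the line
    \<open>Re q = \<beta>\<close>.\<close>
  define w where "w x = (q x - 1) / (q x - 1 - 2 * of_real b)" for x
  have hol: "q holomorphic_on ball 0 1" and re: "\<And>x. cmod x < 1 \<Longrightarrow> Re (q x) < \<beta>"
    using f by (auto simp: class_M_def q_def)
  have ne: "q x - 1 - 2 * of_real b \<noteq> 0" if "cmod x < 1" for x
    using re [OF that] \<open>b > 0\<close> by (auto simp: complex_eq_iff b_def)
  have "w holomorphic_on ball 0 1"
    unfolding w_def using ne by (intro holomorphic_intros hol) auto
  moreover have "w 0 = 0"
    by (simp add: w_def q_def starlike_quotient_def)
  moreover have "cmod (w x) < 1" if "cmod x < 1" for x
  proof -
    have "(cmod (q x - 1))\<^sup>2 < (cmod (q x - 1 - 2 * of_real b))\<^sup>2"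
    proof -
      have "(cmod (q x - 1 - 2 * of_real b))\<^sup>2 - (cmod (q x - 1))\<^sup>2 = 4 * b * (\<beta> - Re (q x))"
        unfolding cmod_power2 by (simp add: b_def algebra_simps power2_eq_square)
      moreover have "4 * b * (\<beta> - Re (q x)) > 0"
        using re [OF that] \<open>b > 0\<close> by simp
      ultimately show ?thesis
        by linarith
    qed
    then have "cmod (q x - 1) < cmod (q x - 1 - 2 * of_real b)"
      by (simp add: power_less_imp_less_base)
    then show ?thesis
      using ne [OF that] by (simp add: w_def norm_divide)
  qed
  ultimately have "cmod (w z) \<le> cmod z"
    using Schwarz_Lemma(1) z by blast
  moreover have "w z = u / (u - 2 * of_real b)" "u - 2 * of_real b \<noteq> 0"
    using ne [OF z] u by (simp_all add: w_def q_def)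
  then have "w z * (1 - 2 * of_real b / u) = 1"
    using u by (simp add: diff_divide_eq_iff)
  then have "cmod (w z) * cmod (1 - 2 * of_real b / u) = 1"
    by (metis norm_mult norm_one)
  ultimately show ?thesis
    by (metis b_def mult_right_mono norm_ge_zero)
qed

section \<open>The extremal function\<close>

text \<open>Logarithmic differentiation of the principal branch, holomorphic since
  \<open>Re (1 - z) > 0\<close>. For \<open>b = \<beta> - 1 > 0\<close> this quotient turns the
  Schwarz map \<open>(q - 1) / (q - 1 - 2 * b)\<close> into the identity, the case of
  equality.\<close>

lemma starlike_quotient_extremal:
  fixes b :: real
  assumes "cmod z < 1"
  shows "((\<lambda>z. z * exp (2 * of_real b * Ln (1 - z))) has_field_derivative
           exp (2 * of_real b * Ln (1 - z)) * (1 - 2 * of_real b * z / (1 - z))) (at z)" (is ?deriv)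
    and "starlike_quotient (\<lambda>z. z * exp (2 * of_real b * Ln (1 - z))) z = 1 - 2 * of_real b * z / (1 - z)"
proof -
  have "Re z < 1"
    using assms complex_Re_le_cmod [of z] by linarith
  then have "1 - z \<notin> \<real>\<^sub>\<le>\<^sub>0" "1 - z \<noteq> 0"
    by (auto simp: complex_nonpos_Reals_iff complex_eq_iff)
  then show ?deriv
    by (auto intro!: derivative_eq_intros simp: field_simps)
  from DERIV_imp_deriv [OF this]
  show "starlike_quotient (\<lambda>z. z * exp (2 * of_real b * Ln (1 - z))) z = 1 - 2 * of_real b * z / (1 - z)"
    by (simp add: starlike_quotient_def)
qed

text \<open>Since \<open>p = 1 / (1 - z)\<close> maps the disc into \<open>Re p > 1 / 2\<close>, the
  quotient \<open>1 + 2 * b - 2 * b * p\<close> has real part below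
  \<open>1 + b = \<beta>\<close>.\<close>

lemma extremal_in_class_M:
  assumes "1 < \<beta>"
  shows "(\<lambda>z. z * exp (2 * of_real (\<beta> - 1) * Ln (1 - z))) \<in> class_M \<beta>"
proof -
  define b where "b = \<beta> - 1"
  define f where "f = (\<lambda>z. z * exp (2 * of_real b * Ln (1 - z)))"
  have "b > 0"
    using assms by (simp add: b_def)
  have deriv: "(f has_field_derivative exp (2 * of_real b * Ln (1 - z)) * (1 - 2 * of_real b * z / (1 - z))) (at z)"
    and q: "starlike_quotient f z = 1 - 2 * of_real b * z / (1 - z)" if "cmod z < 1" for z
    unfolding f_def using starlike_quotient_extremal that by auto
  have "f holomorphic_on ball 0 1"
    by (metis deriv holomorphic_on_open mem_ball_0 open_ball)
  moreover have "f 0 = 0"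
    by (simp add: f_def)
  moreover have "deriv f 0 = 1"
    using DERIV_imp_deriv [OF deriv [of 0]] by simp
  moreover have "starlike_quotient f holomorphic_on ball 0 1"
  proof (rule holomorphic_transform)
    show "(\<lambda>z. 1 - 2 * of_real b * z / (1 - z)) holomorphic_on ball 0 1"
      by (intro holomorphic_intros) auto
  qed (simp add: q)
  moreover have "Re (starlike_quotient f z) < \<beta>" if "cmod z < 1" for z
  proof -
    have "1 - z \<noteq> 0"
      using that by auto
    define p where "p = 1 / (1 - z)"
    have "starlike_quotient f z = of_real (1 + 2 * b) - of_real (2 * b) * p"
      using \<open>1 - z \<noteq> 0\<close> by (simp add: q that p_def field_simps)
    moreover have "Re p > 1 / 2"
    proof -
      have "(cmod z)\<^sup>2 < 1"
        using that by (simp add: power_less_one_iff abs_square_less_1)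
      moreover have pos: "(cmod (1 - z))\<^sup>2 > 0"
        using \<open>1 - z \<noteq> 0\<close> by simp
      \<comment> \<open>Expanded, this is the inequality
        \<open>(cmod z)\<^sup>2 < 1\<close>.\<close>
      ultimately have less: "(cmod (1 - z))\<^sup>2 < 2 * Re (1 - z)"
        unfolding cmod_power2 by (simp add: power2_eq_square algebra_simps)
      have "Re p = Re (1 - z) / (cmod (1 - z))\<^sup>2"
        unfolding p_def by (simp add: Re_divide cmod_power2)
      moreover have "1 / 2 < Re (1 - z) / (cmod (1 - z))\<^sup>2"
        using less pos by (subst pos_less_divide_eq) linarith+
      ultimately show ?thesis
        by simp
    qed
    then have "2 * b * (1 / 2) < 2 * b * Re p"
      using \<open>b > 0\<close> by (intro mult_strict_left_mono) auto
    ultimately have "Re (starlike_quotient f z) < 1 + b"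
      by simp
    then show ?thesis
      by (simp add: b_def)
  qed
  ultimately have "f \<in> class_M \<beta>"
    by (simp add: class_M_def normalized_analytic_def)
  then show ?thesis
    by (simp add: f_def b_def)
qed

section \<open>The radius in terms of the largest distance \<open>d\<close>\<close>

text \<open>
  \<open>X\<close> stands for \<open>- cos t\<close> in \<open>v = (1 - \<alpha>) cos t - \<i> (1 + \<alpha>) sin t\<close>; only the left half of the ellipse
  matters since \<open>c > 0\<close>.
\<close>
lemma booth_starlikeness_radius_class_M:
  fixes \<alpha> \<beta> c d X\<^sub>0 :: real
  assumes \<alpha>: "0 < \<alpha>" "\<alpha> < 1" and \<beta>: "1 < \<beta>" and c: "c = 1 / (2 * (\<beta> - 1))" and d: "0 < d"
    and max: "\<And>X. 0 \<le> X \<Longrightarrow> X \<le> 1 \<Longrightarrow> ((1 - \<alpha>) * X + c)\<^sup>2 + (1 + \<alpha>)\<^sup>2 * (1 - X\<^sup>2) \<le> d\<^sup>2"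
    and X\<^sub>0: "0 \<le> X\<^sub>0" "X\<^sub>0 \<le> 1" "((1 - \<alpha>) * X\<^sub>0 + c)\<^sup>2 + (1 + \<alpha>)\<^sup>2 * (1 - X\<^sub>0\<^sup>2) = d\<^sup>2"
  shows "booth_starlikeness_radius \<alpha> (class_M \<beta>) = c / d"
proof -
  have "c > 0"
    using c \<beta> by simp
  \<comment> \<open>The vertex \<open>-(1 - \<alpha>)\<close> already forces \<open>c < d\<close>,
    so the claimed radius is below 1.\<close>
  have "(1 - \<alpha> + c)\<^sup>2 \<le> d\<^sup>2"
    using max [of 1] by simp
  then have "1 - \<alpha> + c \<le> d"
    by (rule power2_le_imp_le) (use d in simp)
  then have "c < d"
    using \<alpha> by linarith
  define r where "r = c / d"
  have r: "0 < r" "r < 1"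
    using \<open>c > 0\<close> d \<open>c < d\<close> by (simp_all add: r_def)
  define S where
    "S f = {s. 0 < s \<and> s < 1 \<and> (\<forall>z. cmod z \<le> s \<longrightarrow> starlike_quotient f z \<in> booth_fun \<alpha> ` ball 0 1)}" for f
  have bdd: "bdd_above (S f)" for f
    by (rule bdd_aboveI [of _ 1]) (auto simp: S_def)

  \<comment> \<open>Lower bound, valid for the whole class: for \<open>cmod z < r\<close> the
    Schwarz bound puts \<open>v\<close> farther than \<open>d\<close> from \<open>c\<close>, hence
    outside the ellipse.\<close>
  have inside: "starlike_quotient f z \<in> booth_fun \<alpha> ` ball 0 1"
    if f: "f \<in> class_M \<beta>" and z: "cmod z < r" for f z
  proof (cases "starlike_quotient f z = 1")
    case True
    then show ?thesis
      by (intro image_eqI [of _ _ 0]) (simp_all add: booth_fun_def)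
  next
    case False
    define u where "u = starlike_quotient f z - 1"
    have u: "u \<noteq> 0"
      using False by (simp add: u_def)
    define v where "v = 1 / u"
    have bc: "2 * complex_of_real (\<beta> - 1) = 1 / of_real c"
      unfolding c using \<beta> by (simp add: field_simps)
    have "1 - 2 * of_real (\<beta> - 1) / u = (of_real c - v) / of_real c"
      unfolding bc v_def using \<open>c > 0\<close> by (simp add: field_simps)
    then have "1 \<le> cmod z * (cmod (of_real c - v) / c)"
      using starlike_quotient_bound_class_M [OF \<beta> f _ u_def u] z r \<open>c > 0\<close> by (simp add: norm_divide)
    then have le: "c \<le> cmod z * cmod (of_real c - v)"
      using \<open>c > 0\<close> by (simp add: field_simps)
    then have "cmod (of_real c - v) > 0"
      using \<open>c > 0\<close> by (metis less_le_not_le mult_zero_right norm_ge_zero order_less_le)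
    then have "cmod z * cmod (of_real c - v) < r * cmod (of_real c - v)"
      using z by simp
    then have "c < c / d * cmod (of_real c - v)"
      using le by (simp add: r_def)
    then have "d < cmod (of_real c - v)"
      using \<open>c > 0\<close> d by (simp add: field_simps)
    then have far: "d\<^sup>2 < (c - Re v)\<^sup>2 + (Im v)\<^sup>2"
      using power_strict_mono [of d "cmod (of_real c - v)" 2] d by (simp add: cmod_power2)
    have "(Re v / (1 - \<alpha>))\<^sup>2 + (Im v / (1 + \<alpha>))\<^sup>2 > 1"
    proof (rule ccontr)
      assume within: "\<not> 1 < (Re v / (1 - \<alpha>))\<^sup>2 + (Im v / (1 + \<alpha>))\<^sup>2"
      \<comment> \<open>Reflecting \<open>v\<close> into the left half-plane does not decrease its
        distance from \<open>c > 0\<close>, and moving it vertically out to the ellipse does not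
        either; \<open>max\<close> bounds the result.\<close>
      define X where "X = \<bar>Re v\<bar> / (1 - \<alpha>)"
      have le1: "X\<^sup>2 + (Im v)\<^sup>2 / (1 + \<alpha>)\<^sup>2 \<le> 1"
        using within by (simp add: X_def power_divide)
      have "X \<ge> 0"
        using \<alpha> by (simp add: X_def)
      have "(Im v)\<^sup>2 / (1 + \<alpha>)\<^sup>2 \<ge> 0"
        by simp
      then have "X\<^sup>2 \<le> 1"
        using le1 by linarith
      then have "X \<le> 1"
        using \<open>X \<ge> 0\<close> by (simp add: abs_square_le_1)
      have "(Im v)\<^sup>2 / (1 + \<alpha>)\<^sup>2 \<le> 1 - X\<^sup>2"
        using le1 by linarith
      then have "(Im v)\<^sup>2 \<le> (1 + \<alpha>)\<^sup>2 * (1 - X\<^sup>2)"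
        using \<alpha> by (simp add: pos_divide_le_eq mult.commute)
      moreover have "\<bar>c - Re v\<bar> \<le> \<bar>(1 - \<alpha>) * X + c\<bar>"
        using \<alpha> \<open>c > 0\<close> by (simp add: X_def)
      then have "(c - Re v)\<^sup>2 \<le> ((1 - \<alpha>) * X + c)\<^sup>2"
        by (simp only: abs_le_square_iff)
      ultimately show False
        using far max [OF \<open>X \<ge> 0\<close> \<open>X \<le> 1\<close>] by linarith
    qed
    then have "1 + u \<in> booth_fun \<alpha> ` ball 0 1"
      using booth_image_outside_ellipse [OF \<alpha> u] by (simp add: v_def)
    then show ?thesis
      by (simp add: u_def)
  qed
  have in_S: "s \<in> S f" if "f \<in> class_M \<beta>" "0 < s" "s < r" for f s
    using that r inside by (auto simp: S_def)
  \<comment> \<open>Only radii strictly below \<open>r\<close> are known to be admissible, so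
    \<open>r\<close> is approached by density.\<close>
  have lower: "r \<le> Sup (S f)" if "f \<in> class_M \<beta>" for f
    using r(1) by (rule dense_le_bounded) (rule cSup_upper [OF in_S [OF that] bdd])

  define g where "g = (\<lambda>z. z * exp (2 * of_real (\<beta> - 1) * Ln (1 - z)))"
  have g: "g \<in> class_M \<beta>"
    unfolding g_def using extremal_in_class_M \<beta> by blast
  \<comment> \<open>Sharpness: on the circle of radius \<open>r\<close> the extremal quotient meets
    the boundary of the Booth domain.\<close>
  obtain z where z: "cmod z = r" and out: "starlike_quotient g z \<notin> booth_fun \<alpha> ` ball 0 1"
  proof -
    \<comment> \<open>Makes \<open>v\<close> below a point of the ellipse at the maximal distance
      \<open>d\<close> from \<open>c\<close>.\<close>
    define t where "t = arccos (- X\<^sub>0)"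
    have cos_t: "cos t = - X\<^sub>0"
      unfolding t_def using X\<^sub>0 by (intro cos_arccos) auto
    have sin_t: "(sin t)\<^sup>2 = 1 - X\<^sub>0\<^sup>2"
      by (simp add: sin_squared_eq cos_t)
    define v where "v = 1 / cis t - of_real \<alpha> * cis t"
    have v: "v = Complex ((1 - \<alpha>) * (- X\<^sub>0)) (- ((1 + \<alpha>) * sin t))"
      using inverse_minus_of_polar [of 1 t \<alpha>] by (simp add: v_def rcis_def flip: cos_t)
    have "(cmod (of_real c - v))\<^sup>2 = ((1 - \<alpha>) * X\<^sub>0 + c)\<^sup>2 + (1 + \<alpha>)\<^sup>2 * (sin t)\<^sup>2"
      unfolding cmod_power2 v by (simp add: algebra_simps power2_eq_square)
    then have "(cmod (of_real c - v))\<^sup>2 = d\<^sup>2"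
      using X\<^sub>0(3) by (simp add: sin_t)
    then have dist: "cmod (of_real c - v) = d"
      using d by (simp add: power2_eq_iff_nonneg)
    have "v \<noteq> 0"
      using dist \<open>c < d\<close> \<open>c > 0\<close> by auto
    \<comment> \<open>Solves \<open>1 - 2 * (\<beta> - 1) * z / (1 - z) = 1 + 1 / v\<close> for
      \<open>z\<close>.\<close>
    define z where "z = of_real c / (of_real c - v)"
    have "of_real c - v \<noteq> 0"
      using dist d by auto
    have "cmod z = r"
      using dist \<open>c > 0\<close> by (simp add: z_def r_def norm_divide)
    moreover have "starlike_quotient g z = 1 + 1 / v"
    proof -
      have bc: "2 * complex_of_real (\<beta> - 1) = 1 / of_real c"
        unfolding c using \<beta> by (simp add: field_simps)
      have "1 - z = - v / (of_real c - v)"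
        using \<open>of_real c - v \<noteq> 0\<close> by (simp add: z_def field_simps)
      then have "z / (1 - z) = - of_real c / v"
        using \<open>of_real c - v \<noteq> 0\<close> \<open>v \<noteq> 0\<close> by (simp add: z_def)
      moreover have "starlike_quotient g z = 1 - 2 * of_real (\<beta> - 1) * (z / (1 - z))"
        unfolding g_def using starlike_quotient_extremal(2) [of z "\<beta> - 1"] \<open>cmod z = r\<close> r by simp
      ultimately show ?thesis
        unfolding bc using \<open>c > 0\<close> by simp
    qed
    moreover have "1 + 1 / v \<notin> booth_fun \<alpha> ` ball 0 1"
      unfolding v_def using booth_image_avoids_ellipse [OF \<alpha>, of "cis t"] by simp
    ultimately show thesis
      using that by simp
  qed
  have "Sup (S g) \<le> r"
  proof (rule cSup_least)
    show "S g \<noteq> {}"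
      using in_S [OF g, of "r / 2"] r by auto
    show "s \<le> r" if "s \<in> S g" for s
      using that z out by (force simp: S_def)
  qed
  then have "Sup (S g) = r"
    using lower [OF g] by simp
  then have "Inf {Sup (S f) | f. f \<in> class_M \<beta>} = r"
    using g lower by (intro cInf_eq_minimum) auto
  then show ?thesis
    by (simp add: booth_starlikeness_radius_def booth_radius_of_def S_def r_def)
qed

section \<open>Maximizing the distance in the two ranges of \<beta>\<close>

theorem theorem3p5:
  fixes \<alpha> \<beta> :: real
  assumes "0 < \<alpha>" and "\<alpha> < 1" and "1 < \<beta>" and "\<beta> < 4 / 3"
  shows "(\<beta> \<le> 1 + (1 - \<alpha>) / (8 * \<alpha>) \<longrightarrow>
            booth_starlikeness_radius \<alpha> (class_M \<beta>) = 1 / (1 + 2 * (1 - \<alpha>) * (\<beta> - 1))) \<and>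
         (1 + (1 - \<alpha>) / (8 * \<alpha>) \<le> \<beta> \<longrightarrow>
            booth_starlikeness_radius \<alpha> (class_M \<beta>) =
              2 * sqrt \<alpha> / ((1 + \<alpha>) * sqrt (1 + 16 * \<alpha> * (\<beta> - 1)\<^sup>2)))"
proof (intro conjI impI)
  define b where "b = \<beta> - 1"
  define c where "c = 1 / (2 * b)"
  have "b > 0"
    using assms by (simp add: b_def)
  then have "c > 0" and bc: "2 * b * c = 1"
    by (simp_all add: c_def)
  have c: "c = 1 / (2 * (\<beta> - 1))"
    by (simp add: c_def b_def)
  {
    assume "\<beta> \<le> 1 + (1 - \<alpha>) / (8 * \<alpha>)"
    then have "8 * \<alpha> * b \<le> 1 - \<alpha>"
      using assms(1) by (simp add: b_def field_simps)
    then have "8 * \<alpha> * b * c \<le> (1 - \<alpha>) * c"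
      using \<open>c > 0\<close> by (intro mult_right_mono) auto
    moreover have "8 * \<alpha> * b * c = 4 * \<alpha> * (2 * b * c)"
      by simp
    \<comment> \<open>The squared distance, a concave quadratic in \<open>X\<close>, is stationary
      at \<open>(1 - \<alpha>) * c / (4 * \<alpha>)\<close>. Here that is at least 1, so the maximum
      over [0, 1] is at \<open>X = 1\<close>.\<close>
    ultimately have vertex: "4 * \<alpha> \<le> (1 - \<alpha>) * c"
      using bc by simp
    have "booth_starlikeness_radius \<alpha> (class_M \<beta>) = c / (c + (1 - \<alpha>))"
    proof (rule booth_starlikeness_radius_class_M [OF assms(1-3) c, where X\<^sub>0 = 1])
      fix X :: real
      assume X: "0 \<le> X" "X \<le> 1"
      have "4 * \<alpha> * (1 + X) \<le> 4 * \<alpha> * 2"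
        using X assms by (intro mult_left_mono) auto
      then have "0 \<le> 2 * ((1 - \<alpha>) * c) - 4 * \<alpha> * (1 + X)"
        using vertex by linarith
      \<comment> \<open>This product is the right side minus the left side of the goal, using
        \<open>(1 + \<alpha>)\<^sup>2 - (1 - \<alpha>)\<^sup>2 = 4 * \<alpha>\<close>.\<close>
      then have "0 \<le> (1 - X) * (2 * ((1 - \<alpha>) * c) - 4 * \<alpha> * (1 + X))"
        using X by (intro mult_nonneg_nonneg) simp_all
      then show "((1 - \<alpha>) * X + c)\<^sup>2 + (1 + \<alpha>)\<^sup>2 * (1 - X\<^sup>2) \<le> (c + (1 - \<alpha>))\<^sup>2"
        by (simp add: algebra_simps power2_eq_square)
    qed (use \<open>c > 0\<close> assms in \<open>auto simp: add.commute\<close>)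
    also have "\<dots> = 1 / (1 + 2 * (1 - \<alpha>) * b)"
      using \<open>b > 0\<close> \<open>c > 0\<close> assms unfolding c_def by (simp add: field_simps)
    finally show "booth_starlikeness_radius \<alpha> (class_M \<beta>) = 1 / (1 + 2 * (1 - \<alpha>) * (\<beta> - 1))"
      by (simp add: b_def)
  next
    assume "1 + (1 - \<alpha>) / (8 * \<alpha>) \<le> \<beta>"
    then have "1 - \<alpha> \<le> 8 * \<alpha> * b"
      using assms(1) by (simp add: b_def field_simps)
    then have "(1 - \<alpha>) * c \<le> 8 * \<alpha> * b * c"
      using \<open>c > 0\<close> by (intro mult_right_mono) auto
    moreover have "8 * \<alpha> * b * c = 4 * \<alpha> * (2 * b * c)"
      by simp
    ultimately have vertex: "(1 - \<alpha>) * c \<le> 4 * \<alpha>"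
      using bc by simp
    \<comment> \<open>The stationary point again, which now lies in [0, 1].\<close>
    define X\<^sub>0 where "X\<^sub>0 = (1 - \<alpha>) * c / (4 * \<alpha>)"
    have X\<^sub>0: "0 \<le> X\<^sub>0" "X\<^sub>0 \<le> 1" "(1 - \<alpha>) * c = 4 * \<alpha> * X\<^sub>0"
      using assms \<open>c > 0\<close> vertex by (simp_all add: X\<^sub>0_def)
    define d where "d = (1 + \<alpha>) * sqrt (c\<^sup>2 + 4 * \<alpha>) / (2 * sqrt \<alpha>)"
    have "d > 0"
      using assms by (simp add: d_def add_nonneg_pos)
    have d2: "d\<^sup>2 = (1 + \<alpha>)\<^sup>2 * (c\<^sup>2 + 4 * \<alpha>) / (4 * \<alpha>)"
      using assms by (simp add: d_def power_mult_distrib power_divide)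
    \<comment> \<open>Completing the square; \<open>(1 - \<alpha>)\<^sup>2 + 4 * \<alpha> = (1 +
      \<alpha>)\<^sup>2\<close> gives the constant term the closed form
      \<open>d\<^sup>2\<close>.\<close>
    have square: "((1 - \<alpha>) * X + c)\<^sup>2 + (1 + \<alpha>)\<^sup>2 * (1 - X\<^sup>2) = d\<^sup>2 - 4 * \<alpha> * (X - X\<^sub>0)\<^sup>2" for X
      unfolding d2 X\<^sub>0_def using assms(1) by (simp add: field_simps power2_eq_square)
    have "booth_starlikeness_radius \<alpha> (class_M \<beta>) = c / d"
      by (rule booth_starlikeness_radius_class_M [OF assms(1-3) c \<open>d > 0\<close>, where X\<^sub>0 = X\<^sub>0])
        (use X\<^sub>0 assms(1) in \<open>simp_all add: square\<close>)
    also have "\<dots> = 2 * sqrt \<alpha> / ((1 + \<alpha>) * (sqrt (c\<^sup>2 + 4 * \<alpha>) * (2 * b)))"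
      using \<open>b > 0\<close> assms by (simp add: c_def d_def)
    also have "sqrt (c\<^sup>2 + 4 * \<alpha>) * (2 * b) = sqrt ((c\<^sup>2 + 4 * \<alpha>) * (2 * b)\<^sup>2)"
      using \<open>b > 0\<close> by (simp add: real_sqrt_mult)
    also have "(c\<^sup>2 + 4 * \<alpha>) * (2 * b)\<^sup>2 = 1 + 16 * \<alpha> * b\<^sup>2"
      using \<open>b > 0\<close> by (simp add: c_def field_simps power2_eq_square)
    finally show "booth_starlikeness_radius \<alpha> (class_M \<beta>) =
        2 * sqrt \<alpha> / ((1 + \<alpha>) * sqrt (1 + 16 * \<alpha> * (\<beta> - 1)\<^sup>2))"
      by (simp add: b_def)
  }
qed

end
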